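(* Let $\boldsymbol{X}=(X_1,\dots,X_d)=\boldsymbol Y+\boldsymbol Z$ follow the multivariate comonotonic shock Poisson distribution with parameters $(\lambda_1,\dots,\lambda_d)\in(0,\infty)^d$ and $\theta\in[0,1]$, where $\boldsymbol Y=(Y_1,\dots,Y_d)$ and $\boldsymbol Z=(Z_1,\dots,Z_d)$. Then for every $x\in\mathbb N=\{0,1,2,\dots\}$, as $\theta\to0$ with $\lambda_1,\dots,\lambda_d$ fixed, $$F_{M^{\boldsymbol X}}(x)\sim F_{M^{\boldsymbol Y}}(x),\qquad F_{m^{\boldsymbol X}}(x)\sim F_{m^{\boldsymbol Y}}(x).$$
   Context: $\mathcal P(\lambda)$ denotes the Poisson distribution with rate $\lambda\ge0$ ($\mathcal P(0)$ is the point mass at $0$) and $G_\lambda$ its cumulative distribution function. A random vector $(X_1,\dots,X_d)$ follows the multivariate comonotonic shock Poisson distribution with parameters $(\lambda_1,\dots,\lambda_d)\in(0,\infty)^d$ and $\theta\in[0,1]$ if $(X_1,\dots,X_d)=(Y_1,\dots,Y_d)+(Z_1,\dots,Z_d)$, where the vectors $\boldsymbol Y=(Y_1,\dots,Y_d)$ and $\boldsymbol Z=(Z_1,\dots,Z_d)$ are independent of each other and: (i) $Y_1,\dots,Y_d$ are mutually independent with $Y_j\sim\mathcal P((1-\theta)\lambda_j)$; (ii) $Z_1,\dots,Z_d$ are comonotonic with $Z_j\sim\mathcal P(\theta\lambda_j)$, i.e. $(Z_1,\dots,Z_d)=(G_{\theta\lambda_1}^{-1}(U),\dots,G_{\theta\lambda_d}^{-1}(U))$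 for one random variable $U$ uniform on $(0,1)$, where $F^{-1}(u)=\inf\{t\in\mathbb R:F(t)\ge u\}$. (The laws of both $\boldsymbol Y$ and $\boldsymbol Z$ depend on $\theta$.) For a random vector $\boldsymbol\xi=(\xi_1,\dots,\xi_d)$: $M^{\boldsymbol\xi}=\max(\xi_1,\dots,\xi_d)$, $m^{\boldsymbol\xi}=\min(\xi_1,\dots,\xi_d)$. $F_W$ denotes the cumulative distribution function of a random variable $W$. The notation $f(x;\kappa)\sim g(x;\kappa)$ as $\kappa\to\kappa_0$ means $\lim_{\kappa\to\kappa_0}f(x;\kappa)/g(x;\kappa)=1$. *)

theory Defs
  imports "HOL-Probability.Probability"
begin

text \<open>
  Laws and vectors are real-valued; random vectors of dimension \<open>d\<close> take values in \<open>real ^ 'd\<close>, so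
  \<open>d \<ge> 1\<close> is automatic. The library's \<^const>\<open>poisson_pmf\<close> is specified only for positive rates,
  hence the separate clause for rate \<open>0\<close>.
\<close>

definition poisson_law :: "real \<Rightarrow> real measure" where
  "poisson_law r =
     distr (measure_pmf (if r = 0 then return_pmf 0 else poisson_pmf r)) borel real"

text \<open>
  The generalized inverse is only used at levels in \<open>(0, 1)\<close>, where the set is nonempty and
  bounded below if \<open>F\<close> is the distribution function of a probability measure on the reals.
\<close>

definition quantile :: "(real \<Rightarrow> real) \<Rightarrow> real \<Rightarrow> real" where
  "quantile F u = Inf {t. F t \<ge> u}"

text \<open>
  \<open>mcs_poisson M lam \<theta> X Y Z\<close>: on the probability space \<open>M\<close>, \<open>X = Y + Z\<close> follows the multivariate
  comonotonic shock Poisson distribution with parameters \<open>lam\<close> and \<open>\<theta>\<close>. As usual, equalities between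
  random variables are almost sure.
\<close>

definition mcs_poisson ::
  "'a measure \<Rightarrow> real ^ 'd \<Rightarrow> real \<Rightarrow> ('a \<Rightarrow> real ^ 'd) \<Rightarrow> ('a \<Rightarrow> real ^ 'd) \<Rightarrow> ('a \<Rightarrow> real ^ 'd) \<Rightarrow> bool"
  where
  "mcs_poisson M lam \<theta> X Y Z \<longleftrightarrow>
     prob_space M \<and>
     X \<in> borel_measurable M \<and>
     (AE \<omega> in M. X \<omega> = Y \<omega> + Z \<omega>) \<and>
     prob_space.indep_var M borel Y borel Z \<and>
     prob_space.indep_vars M (\<lambda>_. borel) (\<lambda>j \<omega>. Y \<omega> $ j) UNIV \<and>
     (\<forall>j. distr M borel (\<lambda>\<omega>. Y \<omega> $ j) = poisson_law ((1 - \<theta>) * lam $ j)) \<and>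
     (\<exists>U. U \<in> borel_measurable M \<and>
          distr M borel U = uniform_measure lborel {0<..<1} \<and>
          (AE \<omega> in M. \<forall>j. Z \<omega> $ j = quantile (cdf (poisson_law (\<theta> * lam $ j))) (U \<omega>)))"

definition vec_max :: "('a \<Rightarrow> real ^ 'd) \<Rightarrow> 'a \<Rightarrow> real" where
  "vec_max \<xi> \<omega> = Max (range (\<lambda>j. \<xi> \<omega> $ j))"

definition vec_min :: "('a \<Rightarrow> real ^ 'd) \<Rightarrow> 'a \<Rightarrow> real" where
  "vec_min \<xi> \<omega> = Min (range (\<lambda>j. \<xi> \<omega> $ j))"

definition cdf_of :: "'a measure \<Rightarrow> ('a \<Rightarrow> real) \<Rightarrow> real \<Rightarrow> real" where
  "cdf_of M W = cdf (distr M borel W)"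

end

theory Submission
  imports Defs
begin

text \<open>
  The common shock \<open>Z\<close> vanishes with probability tending to \<open>1\<close>: all the quantiles at level \<open>U\<close> are
  \<open>0\<close> as soon as \<open>0 < U \<le> exp (- \<theta> * (\<Sum>j. lam $ j))\<close>. Outside an event of probability
  \<open>1 - exp (- \<theta> * (\<Sum>j. lam $ j))\<close>, therefore, \<open>X = Y\<close>, and the distribution functions of \<open>\<phi>(X)\<close> and
  \<open>\<phi>(Y)\<close> differ by at most this quantity, for every measurable \<open>\<phi>\<close>. If \<open>\<phi>(0) \<le> x\<close>, the
  denominator stays above \<open>P(Y = 0) \<ge> exp (- (\<Sum>j. lam $ j))\<close>, so that the quotient tends to \<open>1\<close>.
\<close>

lemma poisson_law_pos:
  assumes "r > 0"
  shows "poisson_law r = distr (measure_pmf (poisson_pmf r)) borel real"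
  using assms by (simp add: poisson_law_def)

lemma measure_poisson_law_0:
  assumes "r > 0"
  shows "measure (poisson_law r) {0} = exp (- r)"
proof -
  have "real -` {0} \<inter> space (measure_pmf (poisson_pmf r)) = {0}" by auto
  then show ?thesis
    using assms by (simp add: poisson_law_pos measure_distr measure_pmf_single)
qed

lemma cdf_poisson_law_neg:
  assumes "r > 0" "t < 0"
  shows "cdf (poisson_law r) t = 0"
proof -
  have "real -` {..t} \<inter> space (measure_pmf (poisson_pmf r)) = {}" using assms by auto
  then show ?thesis
    using assms by (simp add: poisson_law_pos cdf_def measure_distr del: Int_UNIV_right)
qed

lemma cdf_poisson_law_ge:
  assumes "r > 0" "t \<ge> 0"
  shows "exp (- r) \<le> cdf (poisson_law r) t"
proof -
  interpret prob_space "poisson_law r"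
    by (simp add: poisson_law_def prob_space_measure_pmf prob_space.prob_space_distr)
  have "sets (poisson_law r) = sets borel" by (simp add: poisson_law_def)
  then have "measure (poisson_law r) {0} \<le> measure (poisson_law r) {..t}"
    using assms by (intro finite_measure_mono) auto
  then show ?thesis
    using assms by (simp add: measure_poisson_law_0 cdf_def)
qed

text \<open>The law has no mass on the negative reals and an atom of mass \<open>exp (- r)\<close>
  at 0. Hence \<open>u > 0\<close> rules out every negative \<open>t\<close>, while
  \<open>u \<le> exp (- r)\<close> lets in 0 and everything above it.\<close>

lemma quantile_poisson_law_eq_0:
  assumes "r > 0" "0 < u" "u \<le> exp (- r)"
  shows "quantile (cdf (poisson_law r)) u = 0"
proof -
  have "{t. cdf (poisson_law r) t \<ge> u} = {0..}"
    using cdf_poisson_law_neg[OF \<open>r > 0\<close>] cdf_poisson_law_ge[OF \<open>r > 0\<close>] assms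
    by (force simp: not_le[symmetric])
  then show ?thesis by (simp add: quantile_def)
qed

text \<open>Up to a null set, \<open>A\<close> is contained in the union of \<open>B\<close> and the
  complement of \<open>E\<close>.\<close>

lemma (in prob_space) prob_le_of_AE_imp_on:
  assumes [measurable]: "A \<in> events" "B \<in> events" "E \<in> events"
    and AE: "AE \<omega> in M. \<omega> \<in> E \<longrightarrow> \<omega> \<in> A \<longrightarrow> \<omega> \<in> B"
  shows "prob A \<le> prob B + (1 - prob E)"
proof -
  have "prob A \<le> prob (B \<union> (space M - E))"
    using AE AE_space by (intro finite_measure_mono_AE) (auto elim: eventually_elim2)
  also have "\<dots> \<le> prob B + prob (space M - E)"
    by (intro measure_Un_le) auto
  finally show ?thesis by (simp add: prob_compl)
qed

lemma (in prob_space) abs_prob_diff_le_of_AE_eq_on: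
  assumes "A \<in> events" "B \<in> events" "E \<in> events"
    and "AE \<omega> in M. \<omega> \<in> E \<longrightarrow> (\<omega> \<in> A \<longleftrightarrow> \<omega> \<in> B)"
  shows "\<bar>prob A - prob B\<bar> \<le> 1 - prob E"
proof -
  have "AE \<omega> in M. \<omega> \<in> E \<longrightarrow> \<omega> \<in> A \<longrightarrow> \<omega> \<in> B" "AE \<omega> in M. \<omega> \<in> E \<longrightarrow> \<omega> \<in> B \<longrightarrow> \<omega> \<in> A"
    using assms(4) by auto
  with assms(1-3) show ?thesis
    using prob_le_of_AE_imp_on[of A B E] prob_le_of_AE_imp_on[of B A E] by auto
qed

lemma cdf_of_eq:
  assumes "W \<in> borel_measurable M"
  shows "cdf_of M W x = measure M {\<omega> \<in> space M. W \<omega> \<le> x}"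
  unfolding cdf_of_def cdf_def using assms
  by (subst measure_distr) (auto intro!: arg_cong[where f = "measure M"])

lemma (in prob_space) prob_uniform_le:
  assumes "U \<in> borel_measurable M" "distr M borel U = uniform_measure lborel {0<..<1}"
    and "0 \<le> c" "c < 1"
  shows "prob (U -` {0<..c} \<inter> space M) = c"
proof -
  have "prob (U -` {0<..c} \<inter> space M) = measure (distr M borel U) {0<..c}"
    using assms(1) by (simp add: measure_distr)
  also have "\<dots> = measure lborel ({0<..<1} \<inter> {0<..c})"
    by (simp add: assms(2) measure_uniform_measure)
  also have "{0<..<1} \<inter> {0<..c} = {0<..c}" using assms(4) by auto
  finally show ?thesis using assms(3) by simp
qed

text \<open>At an interior \<theta> both rates, \<open>\<theta> * lam $ j\<close> and
  \<open>(1 - \<theta>) * lam $ j\<close>, are positive, so that the lemmas on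
  \<open>poisson_law\<close> apply; the limit at 0 only sees such \<theta>.\<close>

context
  fixes M :: "'a measure" and lam :: "real ^ 'd" and \<theta> :: real
    and X Y Z :: "'a \<Rightarrow> real ^ 'd"
  assumes lam_pos: "\<And>j. lam $ j > 0"
    and theta: "0 < \<theta>" "\<theta> < 1"
    and mcs: "mcs_poisson M lam \<theta> X Y Z"
begin

interpretation prob_space M
  using mcs by (simp add: mcs_poisson_def)

lemma measurable_X: "X \<in> borel_measurable M"
  using mcs by (simp add: mcs_poisson_def)

lemma measurable_Y: "Y \<in> borel_measurable M"
  using mcs by (auto simp: mcs_poisson_def dest: indep_var_rv1)

lemma lam_le_sum: "lam $ j \<le> (\<Sum>j\<in>UNIV. lam $ j)"
  using lam_pos by (intro member_le_sum) (auto intro: less_imp_le)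

lemma abs_cdf_diff_le:
  assumes [measurable]: "\<phi> \<in> borel_measurable borel"
  shows "\<bar>cdf_of M (\<lambda>\<omega>. \<phi> (X \<omega>)) x - cdf_of M (\<lambda>\<omega>. \<phi> (Y \<omega>)) x\<bar>
           \<le> 1 - exp (- (\<theta> * (\<Sum>j\<in>UNIV. lam $ j)))"
proof -
  \<comment> \<open>The sum bounds every single \<open>lam $ j\<close>, so \<open>c\<close> lies
    below the mass of each \<open>Z $ j\<close> at 0, whatever the index.\<close>
  define c where "c = exp (- (\<theta> * (\<Sum>j\<in>UNIV. lam $ j)))"
  note [measurable] = measurable_X measurable_Y
  from mcs obtain U where U [measurable]: "U \<in> borel_measurable M"
    and dU: "distr M borel U = uniform_measure lborel {0<..<1}"
    and Z: "AE \<omega> in M. \<forall>j. Z \<omega> $ j = quantile (cdf (poisson_law (\<theta> * lam $ j))) (U \<omega>)"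
    and XYZ: "AE \<omega> in M. X \<omega> = Y \<omega> + Z \<omega>"
    by (auto simp: mcs_poisson_def)
  define E where "E = U -` {0<..c} \<inter> space M"
  \<comment> \<open>This gives \<open>c < 1\<close>, hence \<open>{0<..c}\<close> lies inside the
    support of \<open>U\<close> and \<open>E\<close> has probability exactly
    \<open>c\<close>.\<close>
  have "0 < (\<Sum>j\<in>UNIV. lam $ j)"
    using lam_pos by (intro sum_pos) auto
  then have "prob E = c"
    unfolding E_def using theta by (intro prob_uniform_le U dU) (auto simp: c_def)
  have c_le: "c \<le> exp (- (\<theta> * lam $ j))" for j
    using lam_le_sum[of j] theta by (simp add: c_def)
  have "AE \<omega> in M. \<omega> \<in> E \<longrightarrow> X \<omega> = Y \<omega>"
    using Z XYZ
  proof eventually_elim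
    case (elim \<omega>)
    show ?case
    proof
      assume "\<omega> \<in> E"
      \<comment> \<open>Comonotonicity enters here: the same \<open>U\<close> drives all
        coordinates, so one event makes all of them vanish.\<close>
      then have "Z \<omega> $ j = 0" for j
        using elim(1) c_le[of j] theta lam_pos[of j]
        by (simp add: E_def quantile_poisson_law_eq_0)
      then have "Z \<omega> = 0" by (simp add: vec_eq_iff)
      with elim(2) show "X \<omega> = Y \<omega>" by simp
    qed
  qed
  then have "AE \<omega> in M. \<omega> \<in> E \<longrightarrow>
      (\<omega> \<in> {\<omega> \<in> space M. \<phi> (X \<omega>) \<le> x} \<longleftrightarrow> \<omega> \<in> {\<omega> \<in> space M. \<phi> (Y \<omega>) \<le> x})"
    by eventually_elim auto
  then have "\<bar>prob {\<omega> \<in> space M. \<phi> (X \<omega>) \<le> x} - prob {\<omega> \<in> space M. \<phi> (Y \<omega>) \<le> x}\<bar> \<le> 1 - prob E"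
    by (intro abs_prob_diff_le_of_AE_eq_on) (simp_all add: E_def)
  then show ?thesis
    by (simp add: cdf_of_eq \<open>prob E = c\<close> c_def)
qed

text \<open>By independence the probability is the product of the
  \<open>exp (- ((1 - \<theta>) * lam $ j))\<close>. Replacing \<open>1 - \<theta>\<close> by 1
  gives a lower bound free of \<theta>, as the limit requires.\<close>

lemma prob_Y_eq_0_ge: "exp (- (\<Sum>j\<in>UNIV. lam $ j)) \<le> prob {\<omega> \<in> space M. Y \<omega> = 0}"
proof -
  note [measurable] = measurable_Y
  have indep: "indep_vars (\<lambda>_. borel) (\<lambda>j \<omega>. Y \<omega> $ j) UNIV"
    and law: "\<And>j. distr M borel (\<lambda>\<omega>. Y \<omega> $ j) = poisson_law ((1 - \<theta>) * lam $ j)"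
    using mcs by (auto simp: mcs_poisson_def)
  have rv [measurable]: "(\<lambda>\<omega>. Y \<omega> $ j) \<in> borel_measurable M" for j
    using indep by (auto simp: indep_vars_def)
  have coord: "prob ((\<lambda>\<omega>. Y \<omega> $ j) -` {0} \<inter> space M) = exp (- ((1 - \<theta>) * lam $ j))" for j
    using measure_distr[OF rv, of "{0}" j] theta lam_pos[of j]
    by (simp add: law measure_poisson_law_0)
  have "exp (- (\<Sum>j\<in>UNIV. lam $ j)) = (\<Prod>j\<in>UNIV. exp (- lam $ j))"
    by (simp add: exp_sum sum_negf[symmetric])
  also have "\<dots> \<le> (\<Prod>j\<in>UNIV. exp (- ((1 - \<theta>) * lam $ j)))"
    using theta lam_pos by (intro prod_mono) (auto simp: algebra_simps less_imp_le)
  also have "\<dots> = prob (\<Inter>j. (\<lambda>\<omega>. Y \<omega> $ j) -` {0} \<inter> space M)"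
    by (subst indep_varsD[OF indep]) (auto simp: coord)
  also have "(\<Inter>j. (\<lambda>\<omega>. Y \<omega> $ j) -` {0} \<inter> space M) = {\<omega> \<in> space M. Y \<omega> = 0}"
    by (auto simp: vec_eq_iff)
  finally show ?thesis .
qed

lemma cdf_Y_ge:
  assumes [measurable]: "\<phi> \<in> borel_measurable borel" and "\<phi> 0 \<le> x"
  shows "exp (- (\<Sum>j\<in>UNIV. lam $ j)) \<le> cdf_of M (\<lambda>\<omega>. \<phi> (Y \<omega>)) x"
proof -
  note [measurable] = measurable_Y
  have "prob {\<omega> \<in> space M. Y \<omega> = 0} \<le> prob {\<omega> \<in> space M. \<phi> (Y \<omega>) \<le> x}"
    using assms(2) by (intro finite_measure_mono) auto
  with prob_Y_eq_0_ge show ?thesis by (simp add: cdf_of_eq)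
qed

text \<open>The deviation from 1 is the difference of the two values divided by the denominator,
  which is bounded away from 0. The resulting bound involves only \<theta> and
  \<open>lam\<close>.\<close>

lemma abs_cdf_quotient_le:
  assumes "\<phi> \<in> borel_measurable borel" and "\<phi> 0 \<le> x"
  shows "\<bar>cdf_of M (\<lambda>\<omega>. \<phi> (X \<omega>)) x / cdf_of M (\<lambda>\<omega>. \<phi> (Y \<omega>)) x - 1\<bar>
           \<le> (1 - exp (- (\<theta> * (\<Sum>j\<in>UNIV. lam $ j)))) / exp (- (\<Sum>j\<in>UNIV. lam $ j))"
    (is "\<bar>?a / ?b - 1\<bar> \<le> ?c / ?e")
proof -
  have b: "?e \<le> ?b" using assms by (rule cdf_Y_ge)
  moreover have "0 < ?e" by simp
  ultimately have "0 < ?b" by linarith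
  then have "\<bar>?a / ?b - 1\<bar> = \<bar>?a - ?b\<bar> / ?b"
    by (simp add: abs_div_pos diff_divide_distrib)
  also have "\<dots> \<le> ?c / ?e"
    using abs_cdf_diff_le[OF assms(1), of x]
    by (intro frac_le b \<open>0 < ?e\<close> order_trans[OF abs_ge_zero])
  finally show ?thesis .
qed

end

text \<open>The probability space may change with \<theta>: the bound for each \<theta> does not
  depend on it, and it tends to 0 because its numerator does.\<close>

lemma tendsto_cdf_quotient:
  fixes M :: "real \<Rightarrow> 'a measure" and lam :: "real ^ 'd"
    and X Y Z :: "real \<Rightarrow> 'a \<Rightarrow> real ^ 'd"
  assumes lam_pos: "\<And>j. lam $ j > 0"
    and mcs: "\<And>\<theta>. \<theta> \<in> {0..1} \<Longrightarrow> mcs_poisson (M \<theta>) lam \<theta> (X \<theta>) (Y \<theta>) (Z \<theta>)"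
    and \<phi>: "\<phi> \<in> borel_measurable borel" "\<phi> 0 \<le> x"
  shows "((\<lambda>\<theta>. cdf_of (M \<theta>) (\<lambda>\<omega>. \<phi> (X \<theta> \<omega>)) x / cdf_of (M \<theta>) (\<lambda>\<omega>. \<phi> (Y \<theta> \<omega>)) x) \<longlongrightarrow> 1)
           (at 0 within {0..1})"
proof (rule LIM_zero_cancel, rule Lim_null_comparison)
  \<comment> \<open>The punctured filter leaves out 0, and radius 1 leaves out 1.\<close>
  have "\<forall>\<^sub>F \<theta> in at 0 within {0..1}. \<theta> \<in> {0<..<1::real}"
    unfolding eventually_at by (auto simp: dist_real_def intro!: exI[of _ 1])
  then show "\<forall>\<^sub>F \<theta> in at 0 within {0..1}.
      norm (cdf_of (M \<theta>) (\<lambda>\<omega>. \<phi> (X \<theta> \<omega>)) x / cdf_of (M \<theta>) (\<lambda>\<omega>. \<phi> (Y \<theta> \<omega>)) x - 1)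
        \<le> (1 - exp (- (\<theta> * (\<Sum>j\<in>UNIV. lam $ j)))) / exp (- (\<Sum>j\<in>UNIV. lam $ j))"
    by eventually_elim
      (use abs_cdf_quotient_le[OF lam_pos _ _ mcs \<phi>] in simp)
  show "((\<lambda>\<theta>. (1 - exp (- (\<theta> * (\<Sum>j\<in>UNIV. lam $ j)))) / exp (- (\<Sum>j\<in>UNIV. lam $ j))) \<longlongrightarrow> 0)
      (at 0 within {0..1})"
    by (rule tendsto_eq_intros refl | simp)+
qed

theorem proposition4p5:
  fixes M :: "real \<Rightarrow> 'a measure"
    and lam :: "real ^ 'd"
    and X Y Z :: "real \<Rightarrow> 'a \<Rightarrow> real ^ 'd"
    and x :: nat
  assumes "\<And>j. lam $ j > 0"
    and "\<And>\<theta>. \<theta> \<in> {0..1} \<Longrightarrow> mcs_poisson (M \<theta>) lam \<theta> (X \<theta>) (Y \<theta>) (Z \<theta>)"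
  shows "((\<lambda>\<theta>. cdf_of (M \<theta>) (vec_max (X \<theta>)) (real x) / cdf_of (M \<theta>) (vec_max (Y \<theta>)) (real x))
            \<longlongrightarrow> 1) (at 0 within {0..1})
       \<and> ((\<lambda>\<theta>. cdf_of (M \<theta>) (vec_min (X \<theta>)) (real x) / cdf_of (M \<theta>) (vec_min (Y \<theta>)) (real x))
            \<longlongrightarrow> 1) (at 0 within {0..1})"
proof
  have coord: "(\<lambda>v::real^'d. v $ j) \<in> borel_measurable borel" for j
    by (intro borel_measurable_continuous_onI continuous_intros)
  have "(\<lambda>v::real^'d. Max (range (\<lambda>j. v $ j))) \<in> borel_measurable borel"
    using coord by (intro borel_measurable_Max) auto
  \<comment> \<open>The premise left open, \<open>\<phi> 0 \<le> x\<close>, is settled by the final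
    \<open>simp\<close>: the maximum of the zero vector is 0, and \<open>x\<close> is a natural
    number.\<close>
  from tendsto_cdf_quotient[OF assms this, of x]
  show "((\<lambda>\<theta>. cdf_of (M \<theta>) (vec_max (X \<theta>)) (real x) / cdf_of (M \<theta>) (vec_max (Y \<theta>)) (real x))
            \<longlongrightarrow> 1) (at 0 within {0..1})"
    by (simp add: vec_max_def[abs_def])
  have "(\<lambda>v::real^'d. Min (range (\<lambda>j. v $ j))) \<in> borel_measurable borel"
    using coord by (intro borel_measurable_Min) auto
  from tendsto_cdf_quotient[OF assms this, of x]
  show "((\<lambda>\<theta>. cdf_of (M \<theta>) (vec_min (X \<theta>)) (real x) / cdf_of (M \<theta>) (vec_min (Y \<theta>)) (real x))
            \<longlongrightarrow> 1) (at 0 within {0..1})"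
    by (simp add: vec_min_def[abs_def])
qed

end
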